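(* Let $n\ge 1$ and $0\le k\le n-1$. Let $\lambda$ be the one-row partition $(n-2k)$ if $n-2k\ge 1$, and the one-column partition $(1^{2(k+1)-n})$ otherwise. Then $$\mathrm{Spec}\,\mathrm{C}_0(\Lambda^kV_n)=\{(a_1,\dots,a_n)\in\mathbb{Z}^n\mid a_1=0,\ a_n=\mathrm{ct}(\mathrm{b}_\lambda),\ a_{i+1}=a_i\pm1\text{ for }1\le i\le n-1\},$$ where $\mathrm{ct}(\mathrm{b}_\lambda)$ is the content of the unique removable box $\mathrm{b}_\lambda$ of $\lambda$, i.e. $\mathrm{ct}(\mathrm{b}_\lambda)=m-1$ if $\lambda=(m)$ and $\mathrm{ct}(\mathrm{b}_\lambda)=-m+1$ if $\lambda=(1^m)$.
   Context: The periplectic Brauer algebra $A_n$ is the unital associative $\mathbb{C}$-algebra with generators $s_i,e_i$ ($1\le i\le n-1$) and relations (for all indices for which the expressions make sense): $s_i^2=1$; $s_is_j=s_js_i$, $s_ie_j=e_js_i$, $e_ie_j=e_je_i$ if $|i-j|>1$; $s_is_{i+1}s_i=s_{i+1}s_is_{i+1}$; $e_{i+1}e_ie_{i+1}=-e_{i+1}$; $e_ie_{i+1}e_i=-e_i$; $e_is_i=e_i$; $s_ie_i=-e_i$; $s_ie_{i+1}e_i=s_{i+1}e_i$; $s_{i+1}e_ie_{i+1}=-s_ie_{i+1}$; $e_{i+1}e_is_{i+1}=e_{i+1}s_i$; $e_ie_{i+1}s_i=-e_is_{i+1}$; $e_i^2=0$. The Jucys--Murphy elements of $A_n$ are $Y_1:=0$,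 $Y_{j+1}:=s_jY_js_j+s_j+e_j$ for $1\le j\le n-1$. A representation of $A_n$ is calibrated if it has a basis with respect to which all $Y_j$, $1\le j\le n$, act by diagonal matrices. The spectrum $\mathrm{Spec}\,L$ of a calibrated representation $L$ is the set of all $(\alpha_1,\dots,\alpha_n)\in\mathbb{C}^n$ such that there is a nonzero $v\in L$ with $Y_jv=\alpha_jv$ for $j=1,\dots,n$. For $n\ge 1$ and $0\le k\le n-1$, $\mathrm{C}_0(\Lambda^kV_n)$ is the following calibrated $A_n$-representation of dimension $\binom{n-1}{k}$. It has basis $v_S$ indexed by $k$-element subsets $S\subseteq\{1,\dots,n-1\}$. If $i\in S$, then $s_iv_S=-v_S$ and $e_iv_S=0$. If $i\notin S$, then $$s_iv_S=v_S-[i+1\in S]\,v_{(S\setminus\{i+1\})\cup\{i\}}-[i-1\in S]\,v_{(S\setminus\{i-1\})\cup\{i\}},$$ $$e_iv_S=[i+1\in S]\,v_{(S\setminus\{i+1\})\cup\{i\}}-[i-1\in S]\,v_{(S\setminus\{i-1\})\cup\{i\}},$$ where $[P]=1$ if $P$ holds and $[P]=0$ otherwise. The content of a box in row $r$ and column $c$ of a Young diagram is $c-r$. *)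

theory Defs
  imports Complex_Main "HOL-Library.Poly_Mapping" "HOL-Algebra.QuotRing"
begin

section \<open>The periplectic Brauer algebra\<close>

text \<open>
  The free algebra is the monoid algebra over the monoid of words; its product is the
  convolution product that the library puts on finitely supported functions on a monoid.
\<close>

datatype symbol = Sgen nat | Egen nat

datatype word = Word (letters: "symbol list")

instantiation word :: monoid_add
begin
definition zero_word :: word where "0 = Word []"
definition plus_word :: "word \<Rightarrow> word \<Rightarrow> word" where "u + v = Word (letters u @ letters v)"
instance by standard (auto simp: zero_word_def plus_word_def)
end

type_synonym free_alg = "word \<Rightarrow>\<^sub>0 complex"

definition fs :: "nat \<Rightarrow> free_alg" where "fs i = Poly_Mapping.single (Word [Sgen i]) 1"
definition fe :: "nat \<Rightarrow> free_alg" where "fe i = Poly_Mapping.single (Word [Egen i]) 1"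
definition fscalar :: "complex \<Rightarrow> free_alg" where "fscalar c = Poly_Mapping.single 0 c"

definition gens :: "nat \<Rightarrow> symbol set" where
  "gens n = Sgen ` {1..n - 1} \<union> Egen ` {1..n - 1}"

definition free_ring :: "nat \<Rightarrow> free_alg ring" where
  "free_ring n = \<lparr>carrier = {p. \<forall>w \<in> Poly_Mapping.keys p. set (letters w) \<subseteq> gens n},
     mult = (*), one = 1, zero = 0, add = (+)\<rparr>"

inductive defining_relation :: "nat \<Rightarrow> free_alg \<Rightarrow> free_alg \<Rightarrow> bool" for n where
  "i \<in> {1..n-1} \<Longrightarrow> defining_relation n (fs i * fs i) 1"
| "\<lbrakk>i \<in> {1..n-1}; j \<in> {1..n-1}; \<bar>int i - int j\<bar> > 1\<rbrakk> \<Longrightarrow> defining_relation n (fs i * fs j) (fs j * fs i)"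
| "\<lbrakk>i \<in> {1..n-1}; j \<in> {1..n-1}; \<bar>int i - int j\<bar> > 1\<rbrakk> \<Longrightarrow> defining_relation n (fs i * fe j) (fe j * fs i)"
| "\<lbrakk>i \<in> {1..n-1}; j \<in> {1..n-1}; \<bar>int i - int j\<bar> > 1\<rbrakk> \<Longrightarrow> defining_relation n (fe i * fe j) (fe j * fe i)"
| "\<lbrakk>i \<in> {1..n-1}; i+1 \<in> {1..n-1}\<rbrakk> \<Longrightarrow>
    defining_relation n (fs i * fs (i+1) * fs i) (fs (i+1) * fs i * fs (i+1))"
| "\<lbrakk>i \<in> {1..n-1}; i+1 \<in> {1..n-1}\<rbrakk> \<Longrightarrow> defining_relation n (fe (i+1) * fe i * fe (i+1)) (- fe (i+1))"
| "\<lbrakk>i \<in> {1..n-1}; i+1 \<in> {1..n-1}\<rbrakk> \<Longrightarrow> defining_relation n (fe i * fe (i+1) * fe i) (- fe i)"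
| "i \<in> {1..n-1} \<Longrightarrow> defining_relation n (fe i * fs i) (fe i)"
| "i \<in> {1..n-1} \<Longrightarrow> defining_relation n (fs i * fe i) (- fe i)"
| "\<lbrakk>i \<in> {1..n-1}; i+1 \<in> {1..n-1}\<rbrakk> \<Longrightarrow> defining_relation n (fs i * fe (i+1) * fe i) (fs (i+1) * fe i)"
| "\<lbrakk>i \<in> {1..n-1}; i+1 \<in> {1..n-1}\<rbrakk> \<Longrightarrow> defining_relation n (fs (i+1) * fe i * fe (i+1)) (- (fs i * fe (i+1)))"
| "\<lbrakk>i \<in> {1..n-1}; i+1 \<in> {1..n-1}\<rbrakk> \<Longrightarrow> defining_relation n (fe (i+1) * fe i * fs (i+1)) (fe (i+1) * fs i)"
| "\<lbrakk>i \<in> {1..n-1}; i+1 \<in> {1..n-1}\<rbrakk> \<Longrightarrow> defining_relation n (fe i * fe (i+1) * fs i) (- (fe i * fs (i+1)))"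
| "i \<in> {1..n-1} \<Longrightarrow> defining_relation n (fe i * fe i) 0"

definition relation_ideal :: "nat \<Rightarrow> free_alg set" where
  "relation_ideal n = genideal (free_ring n) {p - q | p q. defining_relation n p q}"

definition periplectic_brauer :: "nat \<Rightarrow> free_alg set ring" where
  "periplectic_brauer n = free_ring n Quot relation_ideal n"

definition brauer_class :: "nat \<Rightarrow> free_alg \<Rightarrow> free_alg set" where
  "brauer_class n p = relation_ideal n +>\<^bsub>free_ring n\<^esub> p"

definition s_elem :: "nat \<Rightarrow> nat \<Rightarrow> free_alg set" where "s_elem n i = brauer_class n (fs i)"
definition e_elem :: "nat \<Rightarrow> nat \<Rightarrow> free_alg set" where "e_elem n i = brauer_class n (fe i)"

text \<open>\<open>jucys_murphy n j\<close> is \<open>Y\<^sub>j\<close>; the value at \<open>j = 0\<close> is irrelevant.\<close>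

fun jucys_murphy :: "nat \<Rightarrow> nat \<Rightarrow> free_alg set" where
  "jucys_murphy n 0 = \<zero>\<^bsub>periplectic_brauer n\<^esub>"
| "jucys_murphy n (Suc 0) = \<zero>\<^bsub>periplectic_brauer n\<^esub>"
| "jucys_murphy n (Suc (Suc j)) =
     s_elem n (Suc j) \<otimes>\<^bsub>periplectic_brauer n\<^esub> jucys_murphy n (Suc j)
         \<otimes>\<^bsub>periplectic_brauer n\<^esub> s_elem n (Suc j)
       \<oplus>\<^bsub>periplectic_brauer n\<^esub> s_elem n (Suc j)
       \<oplus>\<^bsub>periplectic_brauer n\<^esub> e_elem n (Suc j)"


section \<open>Representations and their spectrum\<close>

record 'v representation =
  rep_scale :: "complex \<Rightarrow> 'v \<Rightarrow> 'v"
  rep_space :: "'v set"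
  rep_act :: "free_alg set \<Rightarrow> 'v \<Rightarrow> 'v"

definition is_representation :: "nat \<Rightarrow> 'v::ab_group_add representation \<Rightarrow> bool" where
  "is_representation n L \<longleftrightarrow>
     vector_space (rep_scale L) \<and> module.subspace (rep_scale L) (rep_space L) \<and>
     (\<forall>x \<in> carrier (periplectic_brauer n). \<forall>u \<in> rep_space L.
        rep_act L x u \<in> rep_space L \<and>
        (\<forall>v \<in> rep_space L. rep_act L x (u + v) = rep_act L x u + rep_act L x v) \<and>
        (\<forall>c. rep_act L x (rep_scale L c u) = rep_scale L c (rep_act L x u)) \<and>
        (\<forall>y \<in> carrier (periplectic_brauer n).
           rep_act L (x \<otimes>\<^bsub>periplectic_brauer n\<^esub> y) u = rep_act L x (rep_act L y u) \<and>
           rep_act L (x \<oplus>\<^bsub>periplectic_brauer n\<^esub> y) u = rep_act L x u + rep_act L y u)) \<and>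
     (\<forall>c. \<forall>u \<in> rep_space L. rep_act L (brauer_class n (fscalar c)) u = rep_scale L c u)"

text \<open>
  Tuples \<open>(\<alpha>\<^sub>1, \<dots>, \<alpha>\<^sub>n)\<close> are functions on \<open>{1..n}\<close> that are undefined elsewhere.
  The definition makes sense whether or not \<open>L\<close> is calibrated.
\<close>

definition Spec :: "nat \<Rightarrow> 'v::zero representation \<Rightarrow> (nat \<Rightarrow> complex) set" where
  "Spec n L = {\<alpha> \<in> {1..n} \<rightarrow>\<^sub>E UNIV.
     \<exists>v \<in> rep_space L. v \<noteq> 0 \<and> (\<forall>j \<in> {1..n}. rep_act L (jucys_murphy n j) v = rep_scale L (\<alpha> j) v)}"


section \<open>The representation \<open>C\<^sub>0(\<Lambda>\<^sup>k V\<^sub>n)\<close>\<close>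

text \<open>
  The basis vector \<open>v\<^sub>S\<close> is \<open>vb S\<close>. In \<open>gen_on_basis\<close> the index \<open>i - 1\<close> is \<open>0\<close> for \<open>i = 1\<close>, and
  \<open>0 \<notin> S\<close> for every basis vector \<open>vb S\<close> of \<open>C0 n k\<close>. An element of \<open>A\<^sub>n\<close> acts through an arbitrary
  representative in the free algebra; independence of the choice is \<open>C0_act_class\<close> below,
  and \<open>is_representation_C0\<close> shows that the result is a representation.
\<close>

definition pscale :: "complex \<Rightarrow> ('b \<Rightarrow>\<^sub>0 complex) \<Rightarrow> ('b \<Rightarrow>\<^sub>0 complex)" where
  "pscale c f = Poly_Mapping.map ((*) c) f"

definition lin_ext :: "('a \<Rightarrow> ('b \<Rightarrow>\<^sub>0 complex)) \<Rightarrow> ('a \<Rightarrow>\<^sub>0 complex) \<Rightarrow> ('b \<Rightarrow>\<^sub>0 complex)" where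
  "lin_ext g f = (\<Sum>a \<in> Poly_Mapping.keys f. pscale (Poly_Mapping.lookup f a) (g a))"

definition vb :: "nat set \<Rightarrow> (nat set \<Rightarrow>\<^sub>0 complex)" where
  "vb S = Poly_Mapping.single S 1"

fun gen_on_basis :: "symbol \<Rightarrow> nat set \<Rightarrow> (nat set \<Rightarrow>\<^sub>0 complex)" where
  "gen_on_basis (Sgen i) S = (if i \<in> S then - vb S else
     vb S - (if i + 1 \<in> S then vb ((S - {i + 1}) \<union> {i}) else 0)
          - (if i - 1 \<in> S then vb ((S - {i - 1}) \<union> {i}) else 0))"
| "gen_on_basis (Egen i) S = (if i \<in> S then 0 else
     (if i + 1 \<in> S then vb ((S - {i + 1}) \<union> {i}) else 0)
       - (if i - 1 \<in> S then vb ((S - {i - 1}) \<union> {i}) else 0))"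

definition word_on :: "word \<Rightarrow> (nat set \<Rightarrow>\<^sub>0 complex) \<Rightarrow> (nat set \<Rightarrow>\<^sub>0 complex)" where
  "word_on w v = foldr (\<lambda>g. lin_ext (gen_on_basis g)) (letters w) v"

definition free_on :: "free_alg \<Rightarrow> (nat set \<Rightarrow>\<^sub>0 complex) \<Rightarrow> (nat set \<Rightarrow>\<^sub>0 complex)" where
  "free_on p v = lin_ext (\<lambda>w. word_on w v) p"

definition C0 :: "nat \<Rightarrow> nat \<Rightarrow> (nat set \<Rightarrow>\<^sub>0 complex) representation" where
  "C0 n k = \<lparr>rep_scale = pscale,
     rep_space = {v. Poly_Mapping.keys v \<subseteq> {S. S \<subseteq> {1..n - 1} \<and> card S = k}},
     rep_act = (\<lambda>x. free_on (SOME p. p \<in> x))\<rparr>"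


subsection \<open>Well-definedness\<close>

lemma lookup_pscale [simp]: "Poly_Mapping.lookup (pscale c f) a = c * Poly_Mapping.lookup f a"
  unfolding pscale_def by (transfer) (simp add: when_def)

interpretation pscale: vector_space pscale
  by standard (auto intro!: poly_mapping_eqI simp: lookup_add algebra_simps)

lemma lin_ext_superset:
  assumes "finite A" "Poly_Mapping.keys f \<subseteq> A"
  shows "lin_ext g f = (\<Sum>a\<in>A. pscale (Poly_Mapping.lookup f a) (g a))"
  unfolding lin_ext_def
  by (rule sum.mono_neutral_left) (use assms in \<open>auto simp: in_keys_iff\<close>)

lemma lin_ext_add: "lin_ext g (f + h) = lin_ext g f + lin_ext g h"
proof -
  let ?A = "Poly_Mapping.keys f \<union> Poly_Mapping.keys h"
  have "lin_ext g u = (\<Sum>a\<in>?A. pscale (Poly_Mapping.lookup u a) (g a))"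
    if "u \<in> {f, h, f + h}" for u
    by (rule lin_ext_superset) (use that keys_add[of f h] in auto)
  then show ?thesis
    by (simp add: lookup_add pscale.scale_left_distrib sum.distrib)
qed

lemma lin_ext_pscale: "lin_ext g (pscale c f) = pscale c (lin_ext g f)"
proof -
  have "lin_ext g (pscale c f) =
      (\<Sum>a\<in>Poly_Mapping.keys f. pscale (Poly_Mapping.lookup (pscale c f) a) (g a))"
    by (rule lin_ext_superset) (auto simp: in_keys_iff)
  then show ?thesis
    by (simp add: lin_ext_def pscale.scale_sum_right)
qed

lemma lin_ext_zero [simp]: "lin_ext g 0 = 0"
  by (simp add: lin_ext_def)

lemma lin_ext_uminus: "lin_ext g (- f) = - lin_ext g f"
  using lin_ext_pscale[of g "-1" f] by simp

lemma lin_ext_diff: "lin_ext g (f - h) = lin_ext g f - lin_ext g h"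
  using lin_ext_add[of g f "- h"] by (simp add: lin_ext_uminus)

lemma lin_ext_single [simp]: "lin_ext g (Poly_Mapping.single a c) = pscale c (g a)"
  by (cases "c = 0") (simp_all add: lin_ext_def)

lemmas lin_ext_linear = lin_ext_add lin_ext_uminus lin_ext_diff lin_ext_pscale

lemma pscale_single [simp]: "pscale c (Poly_Mapping.single a d) = Poly_Mapping.single a (c * d)"
  by (rule poly_mapping_eqI) (simp add: lookup_single when_def)

lemma pmap_induct [case_names zero single add]:
  fixes f :: "'a \<Rightarrow>\<^sub>0 complex"
  assumes "P 0" and "\<And>a c. a \<in> Poly_Mapping.keys f \<Longrightarrow> P (Poly_Mapping.single a c)"
    and "\<And>g h. P g \<Longrightarrow> P h \<Longrightarrow> P (g + h)"
  shows "P f"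
proof -
  let ?s = "\<lambda>a. Poly_Mapping.single a (Poly_Mapping.lookup f a)"
  have "f = sum ?s (Poly_Mapping.keys f)"
    by (rule poly_mapping_eqI)
      (simp add: lookup_sum lookup_single when_def sum.delta in_keys_iff)
  moreover have "P (sum ?s A)" if "finite A" "A \<subseteq> Poly_Mapping.keys f" for A
    using that by (induction A) (use assms in auto)
  ultimately show ?thesis by (metis finite_keys order_refl)
qed

lemma word_on_zero [simp]: "word_on 0 v = v"
  by (simp add: word_on_def zero_word_def)

lemma word_on_plus: "word_on (u + w) v = word_on u (word_on w v)"
  by (simp add: word_on_def plus_word_def)

lemma foldr_lin_ext_linear:
  "foldr (\<lambda>g. lin_ext (h g)) xs (u + v) = foldr (\<lambda>g. lin_ext (h g)) xs u + foldr (\<lambda>g. lin_ext (h g)) xs v"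
  "foldr (\<lambda>g. lin_ext (h g)) xs (pscale c u) = pscale c (foldr (\<lambda>g. lin_ext (h g)) xs u)"
  by (induction xs) (simp_all add: lin_ext_linear)

lemma word_on_add: "word_on w (u + v) = word_on w u + word_on w v"
  and word_on_pscale: "word_on w (pscale c u) = pscale c (word_on w u)"
  unfolding word_on_def by (rule foldr_lin_ext_linear)+

lemma free_on_zero_left [simp]: "free_on 0 v = 0"
  by (simp add: free_on_def)

lemma free_on_single: "free_on (Poly_Mapping.single w c) v = pscale c (word_on w v)"
  by (simp add: free_on_def)

lemma free_on_left:
  "free_on (p + q) v = free_on p v + free_on q v" "free_on (p - q) v = free_on p v - free_on q v"
  "free_on (- p) v = - free_on p v" "free_on (pscale c p) v = pscale c (free_on p v)"
  by (simp_all add: free_on_def lin_ext_linear)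

lemma free_on_add: "free_on p (u + v) = free_on p u + free_on p v"
  by (simp add: free_on_def lin_ext_def word_on_add pscale.scale_right_distrib sum.distrib)

lemma free_on_pscale: "free_on p (pscale c v) = pscale c (free_on p v)"
  by (simp add: free_on_def lin_ext_def word_on_pscale pscale.scale_sum_right mult.commute)

lemma free_on_zero [simp]: "free_on p 0 = 0"
  using free_on_pscale[of p 0 0] by simp

lemma free_on_mult: "free_on (p * q) v = free_on p (free_on q v)"
proof (induction p rule: pmap_induct)
  case (single w c)
  show ?case
    by (induction q rule: pmap_induct)
      (simp_all add: mult_single free_on_single word_on_plus word_on_pscale word_on_add
        distrib_left free_on_left free_on_add)
qed (simp_all add: distrib_right free_on_left)

lemma free_on_right:
  "free_on p (u - v) = free_on p u - free_on p v" "free_on p (- v) = - free_on p v"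
proof -
  show *: "free_on p (- v) = - free_on p v" for v
    using free_on_pscale[of p "-1" v] by simp
  show "free_on p (u - v) = free_on p u - free_on p v"
    using free_on_add[of p u "- v"] by (simp add: *)
qed

lemma free_on_one [simp]: "free_on 1 v = v"
  by (simp add: free_on_single flip: single_one)

lemma free_on_fs: "free_on (fs i) v = lin_ext (gen_on_basis (Sgen i)) v"
  and free_on_fe: "free_on (fe i) v = lin_ext (gen_on_basis (Egen i)) v"
  by (simp_all add: fs_def fe_def free_on_single word_on_def)

lemma lin_ext_vb [simp]: "lin_ext g (vb S) = g S"
  by (simp add: vb_def)

lemma free_on_eqI:
  assumes "\<And>S. free_on p (vb S) = free_on q (vb S)"
  shows "free_on p v = free_on q v"
proof (induction v rule: pmap_induct)
  case (single S c)
  then show ?case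
    using free_on_pscale[of p c "vb S"] free_on_pscale[of q c "vb S"] assms[of S] by (simp add: vb_def)
qed (simp_all add: free_on_add)

definition put :: "bool \<Rightarrow> nat \<Rightarrow> nat set \<Rightarrow> nat set" where
  "put b x U = (if b then insert x U else U)"

lemma window:
  assumes "\<And>U b c d e. \<lbrakk>x \<notin> U; Suc x \<notin> U; Suc (Suc x) \<notin> U; Suc (Suc (Suc x)) \<notin> U\<rbrakk> \<Longrightarrow>
    P (put b x (put c (Suc x) (put d (Suc (Suc x)) (put e (Suc (Suc (Suc x))) U))))"
  shows "P T"
proof -
  let ?U = "T - {x, Suc x, Suc (Suc x), Suc (Suc (Suc x))}"
  have "T = put (x \<in> T) x (put (Suc x \<in> T) (Suc x) (put (Suc (Suc x) \<in> T) (Suc (Suc x))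
      (put (Suc (Suc (Suc x)) \<in> T) (Suc (Suc (Suc x))) ?U)))"
    by (auto simp: put_def)
  then show ?thesis using assms[of ?U] by (metis Diff_iff insertCI)
qed

lemmas on_basis_simps = free_on_mult free_on_fs free_on_fe free_on_left free_on_right lin_ext_linear
  insert_Diff_if insert_commute

lemma relation_single:
  "free_on (fs (Suc a) * fs (Suc a)) (vb T) = free_on 1 (vb T)"
  "free_on (fe (Suc a) * fs (Suc a)) (vb T) = free_on (fe (Suc a)) (vb T)"
  "free_on (fs (Suc a) * fe (Suc a)) (vb T) = free_on (- fe (Suc a)) (vb T)"
  "free_on (fe (Suc a) * fe (Suc a)) (vb T) = free_on 0 (vb T)"
proof -
  show "free_on (fs (Suc a) * fs (Suc a)) (vb T) = free_on 1 (vb T)"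
    by (rule window[of a _ T], rename_tac U b c d e, case_tac b; case_tac c; case_tac d)
      (simp_all add: put_def on_basis_simps)
  show "free_on (fe (Suc a) * fs (Suc a)) (vb T) = free_on (fe (Suc a)) (vb T)"
    by (rule window[of a _ T], rename_tac U b c d e, case_tac b; case_tac c; case_tac d)
      (simp_all add: put_def on_basis_simps)
  show "free_on (fs (Suc a) * fe (Suc a)) (vb T) = free_on (- fe (Suc a)) (vb T)"
    by (rule window[of a _ T], rename_tac U b c d e, case_tac b; case_tac c; case_tac d)
      (simp_all add: put_def on_basis_simps)
  show "free_on (fe (Suc a) * fe (Suc a)) (vb T) = free_on 0 (vb T)"
    by (rule window[of a _ T], rename_tac U b c d e, case_tac b; case_tac c; case_tac d)
      (simp_all add: put_def on_basis_simps)
qed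

lemma relation_adjacent:
  assumes "i = Suc a"
  shows
  "free_on (fs i * fs (i+1) * fs i) (vb T) = free_on (fs (i+1) * fs i * fs (i+1)) (vb T)"
  "free_on (fe (i+1) * fe i * fe (i+1)) (vb T) = free_on (- fe (i+1)) (vb T)"
  "free_on (fe i * fe (i+1) * fe i) (vb T) = free_on (- fe i) (vb T)"
  "free_on (fs i * fe (i+1) * fe i) (vb T) = free_on (fs (i+1) * fe i) (vb T)"
  "free_on (fs (i+1) * fe i * fe (i+1)) (vb T) = free_on (- (fs i * fe (i+1))) (vb T)"
  "free_on (fe (i+1) * fe i * fs (i+1)) (vb T) = free_on (fe (i+1) * fs i) (vb T)"
  "free_on (fe i * fe (i+1) * fs i) (vb T) = free_on (- (fe i * fs (i+1))) (vb T)"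
proof -
  show "free_on (fs i * fs (i+1) * fs i) (vb T) = free_on (fs (i+1) * fs i * fs (i+1)) (vb T)"
    unfolding assms
    by (rule window[of a _ T], rename_tac U b c d e, case_tac b; case_tac c; case_tac d; case_tac e)
      (simp_all add: put_def on_basis_simps)
  show "free_on (fe (i+1) * fe i * fe (i+1)) (vb T) = free_on (- fe (i+1)) (vb T)"
    unfolding assms
    by (rule window[of a _ T], rename_tac U b c d e, case_tac b; case_tac c; case_tac d; case_tac e)
      (simp_all add: put_def on_basis_simps)
  show "free_on (fe i * fe (i+1) * fe i) (vb T) = free_on (- fe i) (vb T)"
    unfolding assms
    by (rule window[of a _ T], rename_tac U b c d e, case_tac b; case_tac c; case_tac d; case_tac e)
      (simp_all add: put_def on_basis_simps)
  show "free_on (fs i * fe (i+1) * fe i) (vb T) = free_on (fs (i+1) * fe i) (vb T)"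
    unfolding assms
    by (rule window[of a _ T], rename_tac U b c d e, case_tac b; case_tac c; case_tac d; case_tac e)
      (simp_all add: put_def on_basis_simps)
  show "free_on (fs (i+1) * fe i * fe (i+1)) (vb T) = free_on (- (fs i * fe (i+1))) (vb T)"
    unfolding assms
    by (rule window[of a _ T], rename_tac U b c d e, case_tac b; case_tac c; case_tac d; case_tac e)
      (simp_all add: put_def on_basis_simps)
  show "free_on (fe (i+1) * fe i * fs (i+1)) (vb T) = free_on (fe (i+1) * fs i) (vb T)"
    unfolding assms
    by (rule window[of a _ T], rename_tac U b c d e, case_tac b; case_tac c; case_tac d; case_tac e)
      (simp_all add: put_def on_basis_simps)
  show "free_on (fe i * fe (i+1) * fs i) (vb T) = free_on (- (fe i * fs (i+1))) (vb T)"
    unfolding assms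
    by (rule window[of a _ T], rename_tac U b c d e, case_tac b; case_tac c; case_tac d; case_tac e)
      (simp_all add: put_def on_basis_simps)
qed

lemma Diff_singleton_commute: "A - {x} - {y} = A - {y} - {x}"
  by blast

lemma relation_distant:
  assumes "a + 1 < b" "g = Sgen (Suc a) \<or> g = Egen (Suc a)" "h = Sgen (Suc b) \<or> h = Egen (Suc b)"
  shows "lin_ext (gen_on_basis g) (lin_ext (gen_on_basis h) (vb T)) =
         lin_ext (gen_on_basis h) (lin_ext (gen_on_basis g) (vb T))"
  using assms
  by (elim disjE) (simp_all add: lin_ext_linear insert_Diff_if insert_commute Diff_singleton_commute)

lemma relation_distant':
  assumes "i \<ge> 1" "j \<ge> 1" "\<bar>int i - int j\<bar> > 1" "g = Sgen i \<or> g = Egen i" "h = Sgen j \<or> h = Egen j"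
  shows "lin_ext (gen_on_basis g) (lin_ext (gen_on_basis h) (vb T)) =
         lin_ext (gen_on_basis h) (lin_ext (gen_on_basis g) (vb T))"
proof -
  obtain a b where ab: "i = Suc a" "j = Suc b"
    using assms by (metis Suc_le_D One_nat_def)
  then consider "a + 1 < b" | "b + 1 < a" using assms(3) by linarith
  then show ?thesis
    using relation_distant[of a b g h T] relation_distant[of b a h g T] assms(4,5) ab by cases auto
qed

lemma relation_holds:
  assumes "defining_relation n p q"
  shows "free_on p v = free_on q v"
proof (rule free_on_eqI)
  have Suc_ex: "\<exists>a. i = Suc a" if "i \<in> {1..n-1}" for i
    using that by (cases i) auto
  show "free_on p (vb T) = free_on q (vb T)" for T
    using assms
  proof cases
    case (1 i) then show ?thesis using relation_single(1) Suc_ex by blast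
  next
    case (8 i) then show ?thesis using relation_single(2) Suc_ex by blast
  next
    case (9 i) then show ?thesis using relation_single(3) Suc_ex by blast
  next
    case (14 i) then show ?thesis using relation_single(4) Suc_ex by blast
  next
    case (5 i) then show ?thesis using relation_adjacent(1) Suc_ex by blast
  next
    case (6 i) then show ?thesis using relation_adjacent(2) Suc_ex by blast
  next
    case (7 i) then show ?thesis using relation_adjacent(3) Suc_ex by blast
  next
    case (10 i) then show ?thesis using relation_adjacent(4) Suc_ex by blast
  next
    case (11 i) then show ?thesis using relation_adjacent(5) Suc_ex by blast
  next
    case (12 i) then show ?thesis using relation_adjacent(6) Suc_ex by blast
  next
    case (13 i) then show ?thesis using relation_adjacent(7) Suc_ex by blast
  qed (simp_all only: free_on_mult free_on_fs free_on_fe, (rule relation_distant'; simp)+)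
qed

lemma free_ring_simps [simp]:
  "mult (free_ring n) = (*)" "one (free_ring n) = 1" "zero (free_ring n) = 0" "add (free_ring n) = (+)"
  by (simp_all add: free_ring_def)

lemma free_ring_carrier:
  "p \<in> carrier (free_ring n) \<longleftrightarrow> (\<forall>w \<in> Poly_Mapping.keys p. set (letters w) \<subseteq> gens n)"
  by (simp add: free_ring_def)

lemma free_ring_closed:
  "0 \<in> carrier (free_ring n)" "1 \<in> carrier (free_ring n)" "fscalar c \<in> carrier (free_ring n)"
  "i \<in> {1..n-1} \<Longrightarrow> fs i \<in> carrier (free_ring n)" "i \<in> {1..n-1} \<Longrightarrow> fe i \<in> carrier (free_ring n)"
  "p \<in> carrier (free_ring n) \<Longrightarrow> - p \<in> carrier (free_ring n)"
  by (auto simp: free_ring_carrier fscalar_def fs_def fe_def gens_def zero_word_def in_keys_iff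
      split: if_splits)

lemma free_ring_add:
  assumes "p \<in> carrier (free_ring n)" "q \<in> carrier (free_ring n)"
  shows "p + q \<in> carrier (free_ring n)" "p - q \<in> carrier (free_ring n)"
proof -
  have *: "p + q \<in> carrier (free_ring n)" if "q \<in> carrier (free_ring n)" for q
    using assms(1) that keys_add[of p q] by (auto simp: free_ring_carrier)
  show "p + q \<in> carrier (free_ring n)" "p - q \<in> carrier (free_ring n)"
    using *[of q] *[of "- q"] assms(2) free_ring_closed(6)[of q n] by simp_all
qed

lemma free_ring_mult:
  assumes "p \<in> carrier (free_ring n)" "q \<in> carrier (free_ring n)"
  shows "p * q \<in> carrier (free_ring n)"
  unfolding free_ring_carrier
proof
  fix w assume "w \<in> Poly_Mapping.keys (p * q)"
  then obtain u v where "w = u + v" "u \<in> Poly_Mapping.keys p" "v \<in> Poly_Mapping.keys q"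
    using keys_mult[of p q] by blast
  then show "set (letters w) \<subseteq> gens n"
    using assms by (auto simp: free_ring_carrier plus_word_def)
qed

lemma ring_free_ring: "ring (free_ring n)"
proof (rule ringI)
  show "abelian_group (free_ring n)"
  proof (rule abelian_groupI)
    show "\<exists>q\<in>carrier (free_ring n). q \<oplus>\<^bsub>free_ring n\<^esub> p = \<zero>\<^bsub>free_ring n\<^esub>"
      if "p \<in> carrier (free_ring n)" for p
      by (rule bexI[of _ "- p"]) (use that free_ring_closed(6) in auto)
  qed (auto simp: free_ring_closed free_ring_add add_ac)
  show "Group.monoid (free_ring n)"
    by (rule monoidI) (auto simp: free_ring_closed free_ring_mult mult.assoc)
qed (auto simp: algebra_simps)

lemma minus_free_ring [simp]:
  assumes "p \<in> carrier (free_ring n)"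
  shows "\<ominus>\<^bsub>free_ring n\<^esub> p = - p"
proof -
  interpret ring "free_ring n" by (rule ring_free_ring)
  show ?thesis
    using minus_equality[of "- p" p] assms free_ring_closed(6)[OF assms] by simp
qed

lemma relators_closed: "{p - q | p q. defining_relation n p q} \<subseteq> carrier (free_ring n)"
proof clarify
  fix p q assume "defining_relation n p q"
  then show "p - q \<in> carrier (free_ring n)"
    by cases (auto intro!: free_ring_add free_ring_mult free_ring_closed)
qed

lemma ideal_relation_ideal: "ideal (relation_ideal n) (free_ring n)"
  unfolding relation_ideal_def by (rule ring.genideal_ideal[OF ring_free_ring relators_closed])

lemma relation_ideal_acts_zero:
  assumes "p \<in> relation_ideal n"
  shows "free_on p v = 0"
proof -
  let ?K = "{p \<in> carrier (free_ring n). \<forall>v. free_on p v = 0}"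
  interpret ring "free_ring n" by (rule ring_free_ring)
  have "ideal ?K (free_ring n)"
  proof (rule idealI[OF ring_free_ring])
    show "subgroup ?K (add_monoid (free_ring n))"
      by (rule add.subgroupI)
        (auto simp: free_ring_closed free_ring_add free_on_left simp flip: a_inv_def
          intro: exI[of _ 0])
  qed (auto simp: free_ring_mult free_on_mult)
  then have "relation_ideal n \<subseteq> ?K"
    unfolding relation_ideal_def
    by (rule genideal_minimal) (use relators_closed relation_holds in \<open>fastforce simp: free_on_left\<close>)
  then show ?thesis using assms by blast
qed

lemma C0_act_class:
  assumes "p \<in> carrier (free_ring n)"
  shows "rep_act (C0 n k) (brauer_class n p) v = free_on p v"
proof -
  interpret ideal "relation_ideal n" "free_ring n" by (rule ideal_relation_ideal)
  have "p \<in> brauer_class n p"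
    unfolding brauer_class_def using a_rcos_self assms by blast
  then have "(SOME q. q \<in> brauer_class n p) \<in> brauer_class n p"
    by (rule someI)
  then obtain r where "r \<in> relation_ideal n" "(SOME q. q \<in> brauer_class n p) = r + p"
    unfolding brauer_class_def a_r_coset_def' by auto
  then show ?thesis
    by (simp add: C0_def free_on_left relation_ideal_acts_zero)
qed

lemma brauer_class_ops:
  assumes "p \<in> carrier (free_ring n)" "q \<in> carrier (free_ring n)"
  shows "brauer_class n p \<otimes>\<^bsub>periplectic_brauer n\<^esub> brauer_class n q = brauer_class n (p * q)"
    and "brauer_class n p \<oplus>\<^bsub>periplectic_brauer n\<^esub> brauer_class n q = brauer_class n (p + q)"
    and "\<zero>\<^bsub>periplectic_brauer n\<^esub> = brauer_class n 0"
proof -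
  interpret ideal "relation_ideal n" "free_ring n" by (rule ideal_relation_ideal)
  show "brauer_class n p \<otimes>\<^bsub>periplectic_brauer n\<^esub> brauer_class n q = brauer_class n (p * q)"
    using rcoset_mult_add[OF assms] by (simp add: brauer_class_def periplectic_brauer_def FactRing_def)
  show "brauer_class n p \<oplus>\<^bsub>periplectic_brauer n\<^esub> brauer_class n q = brauer_class n (p + q)"
    using a_rcos_sum[OF assms] by (simp add: brauer_class_def periplectic_brauer_def FactRing_def)
  show "\<zero>\<^bsub>periplectic_brauer n\<^esub> = brauer_class n 0"
    using a_rcos_zero[OF ideal_relation_ideal additive_subgroup.zero_closed[OF is_additive_subgroup]]
    by (simp add: brauer_class_def periplectic_brauer_def FactRing_def)
qed

lemma carrier_periplectic_brauer:
  "carrier (periplectic_brauer n) = brauer_class n ` carrier (free_ring n)"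
  by (auto simp: periplectic_brauer_def FactRing_def A_RCOSETS_def' brauer_class_def)

lemma subspace_supported: "pscale.subspace {v. Poly_Mapping.keys v \<subseteq> A}"
proof (rule pscale.subspaceI)
  fix u v :: "'a \<Rightarrow>\<^sub>0 complex"
  assume "u \<in> {v. Poly_Mapping.keys v \<subseteq> A}" "v \<in> {v. Poly_Mapping.keys v \<subseteq> A}"
  then show "u + v \<in> {v. Poly_Mapping.keys v \<subseteq> A}"
    using keys_add[of u v] by auto
qed (auto simp: in_keys_iff)

lemma lin_ext_in_subspace:
  "pscale.subspace V \<Longrightarrow> (\<And>a. a \<in> Poly_Mapping.keys f \<Longrightarrow> g a \<in> V) \<Longrightarrow> lin_ext g f \<in> V"
  unfolding lin_ext_def by (intro pscale.subspace_sum pscale.subspace_scale)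

lemma gen_on_basis_closed:
  assumes "g \<in> gens n" "S \<subseteq> {1..n - 1}"
  shows "Poly_Mapping.keys (gen_on_basis g S) \<subseteq> {T. T \<subseteq> {1..n - 1} \<and> card T = card S}"
proof -
  define V :: "(nat set \<Rightarrow>\<^sub>0 complex) set"
    where "V = {v. Poly_Mapping.keys v \<subseteq> {T. T \<subseteq> {1..n - 1} \<and> card T = card S}}"
  have V: "pscale.subspace V" unfolding V_def by (rule subspace_supported)
  have fin: "finite S" using assms(2) finite_subset by blast
  have base: "vb S \<in> V"
    using assms by (auto simp: vb_def V_def)
  have move: "vb (S - {j} \<union> {i}) \<in> V"
    if "i \<in> {1..n-1}" "i \<notin> S" "j \<in> S" for i j
    using that assms(2) fin card_Suc_Diff1[OF fin] by (auto simp: vb_def V_def)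
  have "gen_on_basis (Sgen i) S \<in> V" "gen_on_basis (Egen i) S \<in> V" if "i \<in> {1..n-1}" for i
    using base move[OF that] pscale.subspace_diff[OF V] pscale.subspace_neg[OF V]
      pscale.subspace_0[OF V] by (simp_all del: Un_insert_right)
  then have "gen_on_basis g S \<in> V"
    using assms(1) unfolding gens_def by blast
  then show ?thesis by (simp add: V_def)
qed

lemma free_on_closed:
  assumes "p \<in> carrier (free_ring n)" "v \<in> rep_space (C0 n k)"
  shows "free_on p v \<in> rep_space (C0 n k)"
proof -
  have S: "pscale.subspace (rep_space (C0 n k))"
    unfolding C0_def by (simp add: subspace_supported)
  have "foldr (\<lambda>g. lin_ext (gen_on_basis g)) xs v \<in> rep_space (C0 n k)" if "set xs \<subseteq> gens n" for xs
    using that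
  proof (induction xs)
    case (Cons g xs)
    let ?u = "foldr (\<lambda>g. lin_ext (gen_on_basis g)) xs v"
    have "gen_on_basis g S \<in> rep_space (C0 n k)" if "S \<in> Poly_Mapping.keys ?u" for S
      using gen_on_basis_closed[of g n S] Cons that by (auto simp: C0_def)
    then show ?case
      using lin_ext_in_subspace[OF S, of ?u "gen_on_basis g"] by simp
  qed (use assms in simp)
  then show ?thesis
    using assms(1) unfolding free_on_def word_on_def
    by (intro lin_ext_in_subspace[OF S]) (auto simp: free_ring_carrier)
qed

lemma is_representation_C0: "is_representation n (C0 n k)"
proof -
  have scale: "rep_scale (C0 n k) = pscale" by (simp add: C0_def)
  have "pscale.subspace (rep_space (C0 n k))"
    unfolding C0_def by (simp add: subspace_supported)
  then show ?thesis
    unfolding is_representation_def carrier_periplectic_brauer scale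
    by (auto simp: brauer_class_ops C0_act_class free_ring_add free_ring_mult free_on_closed
        free_on_add free_on_pscale free_on_mult free_on_left free_ring_closed pscale.vector_space_axioms
        fscalar_def[symmetric])
      (simp add: fscalar_def free_on_single)
qed

lemma C0_act_generators:
  assumes "i \<in> {1..n - 1}"
  shows "rep_act (C0 n k) (s_elem n i) (vb S) = gen_on_basis (Sgen i) S"
    and "rep_act (C0 n k) (e_elem n i) (vb S) = gen_on_basis (Egen i) S"
  using assms
  by (simp_all add: s_elem_def e_elem_def C0_act_class free_ring_closed free_on_fs free_on_fe
      del: gen_on_basis.simps)

section \<open>Partitions and contents\<close>

definition is_partition :: "nat list \<Rightarrow> bool" where
  "is_partition l \<longleftrightarrow> sorted_wrt (\<ge>) l \<and> (\<forall>m \<in> set l. m \<ge> 1)"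

definition young_diagram :: "nat list \<Rightarrow> (nat \<times> nat) set" where
  "young_diagram l = {(r, c). 1 \<le> r \<and> r \<le> length l \<and> 1 \<le> c \<and> c \<le> l ! (r - 1)}"

definition removable_box :: "nat list \<Rightarrow> nat \<times> nat \<Rightarrow> bool" where
  "removable_box l b \<longleftrightarrow> b \<in> young_diagram l \<and>
     (\<exists>m. is_partition m \<and> young_diagram m = young_diagram l - {b})"

definition content :: "nat \<times> nat \<Rightarrow> int" where
  "content b = int (snd b) - int (fst b)"

definition row_or_column :: "nat \<Rightarrow> nat \<Rightarrow> nat list" where
  "row_or_column n k =
     (if int n - 2 * int k \<ge> 1 then [n - 2 * k] else replicate (2 * (k + 1) - n) 1)"

lemma young_diagram_row: "young_diagram [m] = {1} \<times> {1..m}"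
  by (auto simp: young_diagram_def)

lemma young_diagram_column: "young_diagram (replicate m 1) = {1..m} \<times> {1}"
  by (auto simp: young_diagram_def)

lemma young_diagram_left: "(r, c) \<in> young_diagram l \<Longrightarrow> 1 \<le> d \<Longrightarrow> d \<le> c \<Longrightarrow> (r, d) \<in> young_diagram l"
  by (auto simp: young_diagram_def)

lemma young_diagram_up:
  assumes "is_partition l" "(r, 1) \<in> young_diagram l" "1 \<le> t" "t \<le> r"
  shows "(t, 1) \<in> young_diagram l"
proof -
  have "t - 1 < length l" using assms by (auto simp: young_diagram_def)
  then have "l ! (t - 1) \<ge> 1"
    using assms(1) nth_mem[of "t - 1" l] unfolding is_partition_def by blast
  then show ?thesis using assms by (auto simp: young_diagram_def)
qed

lemma content_removable_row:
  assumes "m \<ge> 1"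
  shows "\<exists>!b. removable_box [m] b" and "content (THE b. removable_box [m] b) = int m - 1"
proof -
  have ex: "removable_box [m] (1, m)"
  proof -
    have "young_diagram (if m = 1 then [] else [m - 1]) = young_diagram [m] - {(1, m)}"
      using assms by (auto simp: young_diagram_def)
    moreover have "is_partition (if m = 1 then [] else [m - 1])"
      using assms by (auto simp: is_partition_def)
    ultimately show ?thesis
      using assms unfolding removable_box_def young_diagram_row by auto
  qed
  have un: "b = (1, m)" if b: "removable_box [m] b" for b
  proof (rule ccontr)
    assume ne: "b \<noteq> (1, m)"
    obtain c l where c: "b = (1, c)" "1 \<le> c" "c \<le> m" and l: "young_diagram l = young_diagram [m] - {b}"
      using b unfolding removable_box_def young_diagram_row by auto
    have "(1, m) \<in> young_diagram l"
      using ne l assms unfolding young_diagram_row by auto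
    then have "b \<in> young_diagram l" using young_diagram_left c by blast
    then show False using l by blast
  qed
  show "\<exists>!b. removable_box [m] b" using ex un by blast
  have "(THE b. removable_box [m] b) = (1, m)" using ex un by (rule the_equality)
  then show "content (THE b. removable_box [m] b) = int m - 1" by (simp add: content_def)
qed

lemma content_removable_column:
  assumes "m \<ge> 1"
  shows "\<exists>!b. removable_box (replicate m 1) b"
    and "content (THE b. removable_box (replicate m 1) b) = - int m + 1"
proof -
  have ex: "removable_box (replicate m 1) (m, 1)"
  proof -
    have "young_diagram (replicate (m - 1) 1) = young_diagram (replicate m 1) - {(m, 1)}"
      using assms unfolding young_diagram_column by auto
    moreover have "is_partition (replicate (m - 1) 1)"
      by (auto simp: is_partition_def sorted_wrt_iff_nth_less)
    ultimately show ?thesis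
      using assms unfolding removable_box_def by (metis SigmaI atLeastAtMost_iff order_refl
        singletonI young_diagram_column)
  qed
  have un: "b = (m, 1)" if b: "removable_box (replicate m 1) b" for b
  proof (rule ccontr)
    assume ne: "b \<noteq> (m, 1)"
    obtain r l where r: "b = (r, 1)" "1 \<le> r" "r \<le> m"
      and l: "is_partition l" "young_diagram l = young_diagram (replicate m 1) - {b}"
      using b unfolding removable_box_def young_diagram_column by auto
    have "(m, 1) \<in> young_diagram l"
      using ne l assms unfolding young_diagram_column by auto
    then have "b \<in> young_diagram l" using young_diagram_up l(1) r by blast
    then show False using l by blast
  qed
  show "\<exists>!b. removable_box (replicate m 1) b" using ex un by blast
  have "(THE b. removable_box (replicate m 1) b) = (m, 1)" using ex un by (rule the_equality)
  then show "content (THE b. removable_box (replicate m 1) b) = - int m + 1" by (simp add: content_def)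
qed

end

theory Submission
  imports Defs
begin

text \<open>
  Induction on \<open>j\<close> shows that the Jucys--Murphy elements are diagonal in the given basis:
  \<open>Y\<^sub>j v\<^sub>S = (j - 1 - 2 |S \<inter> {1..j-1}|) v\<^sub>S\<close>. So the weight of \<open>v\<^sub>S\<close> is the lattice path that
  starts at \<open>0\<close> and steps down exactly at the indices in \<open>S\<close>; it ends at \<open>n - 1 - 2k\<close>, which is the
  content of the removable box for the row as well as for the column. Every such path arises
  from the set of its down-steps.
\<close>

text \<open>Lifts the recursion for \<open>jucys_murphy\<close> to the free algebra, so that
  \<open>C0_act_class\<close> replaces the chosen representative of a class by an explicit
  one.\<close>

fun free_jucys_murphy :: "nat \<Rightarrow> free_alg" where
  "free_jucys_murphy 0 = 0"
| "free_jucys_murphy (Suc 0) = 0"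
| "free_jucys_murphy (Suc (Suc j)) =
     fs (Suc j) * free_jucys_murphy (Suc j) * fs (Suc j) + fs (Suc j) + fe (Suc j)"

lemma free_jucys_murphy_closed:
  "j \<le> n \<Longrightarrow> free_jucys_murphy j \<in> carrier (free_ring n)"
  by (induction j rule: free_jucys_murphy.induct)
    (auto intro!: free_ring_add free_ring_mult free_ring_closed)

lemma jucys_murphy_eq_class:
  "j \<le> n \<Longrightarrow> jucys_murphy n j = brauer_class n (free_jucys_murphy j)"
proof (induction j rule: free_jucys_murphy.induct)
  case (3 j)
  then have "fs (Suc j) \<in> carrier (free_ring n)" "fe (Suc j) \<in> carrier (free_ring n)"
    "free_jucys_murphy (Suc j) \<in> carrier (free_ring n)"
    by (auto intro: free_ring_closed free_jucys_murphy_closed)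
  with 3 show ?case
    by (simp add: s_elem_def e_elem_def brauer_class_ops free_ring_add free_ring_mult)
qed (simp_all add: brauer_class_ops(3)[OF free_ring_closed(1) free_ring_closed(1)])

definition weight :: "nat set \<Rightarrow> nat \<Rightarrow> complex" where
  "weight S j = of_nat (j - 1) - 2 * of_nat (card (S \<inter> {1..<j}))"

lemma weight_one [simp]: "weight S (Suc 0) = 0"
  by (simp add: weight_def)

lemma weight_Suc_Suc:
  "weight S (Suc (Suc j)) = weight S (Suc j) + (if Suc j \<in> S then -1 else 1)"
proof -
  have "S \<inter> {1..<Suc (Suc j)} =
      (if Suc j \<in> S then insert (Suc j) (S \<inter> {1..<Suc j}) else S \<inter> {1..<Suc j})"
    by (auto simp: less_Suc_eq)
  then show ?thesis by (auto simp: weight_def)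
qed

lemma weight_cong: "S \<inter> {1..<j} = T \<inter> {1..<j} \<Longrightarrow> weight S j = weight T j"
  by (simp add: weight_def)

text \<open>
  For \<open>i = j + 1 \<notin> S\<close> the two moved terms of \<open>s\<^sub>i v\<^sub>S\<close> have \<open>Y\<^sub>i\<close>-eigenvalues \<open>d\<close> and \<open>d + 2\<close>, where
  \<open>d\<close> is that of \<open>v\<^sub>S\<close>; the resulting off-diagonal term of \<open>s\<^sub>i Y\<^sub>i s\<^sub>i\<close> cancels that of \<open>s\<^sub>i + e\<^sub>i\<close>.
\<close>

lemma free_jucys_murphy_vb:
  assumes "0 \<notin> S"
  shows "free_on (free_jucys_murphy (Suc j)) (vb S) = pscale (weight S (Suc j)) (vb S)"
  using assms
proof (induction j arbitrary: S)
  case (Suc j)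
  let ?i = "Suc j" and ?d = "weight S (Suc j)"
  let ?A = "S - {Suc ?i} \<union> {?i}" and ?B = "S - {j} \<union> {?i}"
  have A: "weight ?A ?i = ?d"
    by (rule weight_cong) auto
  \<comment> \<open>Moving a down-step from \<open>j\<close> to \<open>j + 1\<close> leaves one
    element fewer below \<open>?i\<close>. Since \<open>0 \<notin> S\<close>, \<open>j\<close> is
    positive and was counted.\<close>
  have B: "weight ?B ?i = ?d + 2" if j: "j \<in> S"
  proof -
    from j Suc.prems obtain m where m: "j = Suc m" by (cases j) auto
    have "weight ?B (Suc m) = weight S (Suc m)"
      by (rule weight_cong) (auto simp: m)
    then show ?thesis using weight_Suc_Suc[of ?B m] weight_Suc_Suc[of S m] j m by simp
  qed
  have "0 \<notin> ?A" "0 \<notin> ?B" using Suc.prems by auto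
  then have Y: "free_on (free_jucys_murphy ?i) (vb S) = pscale ?d (vb S)"
      "free_on (free_jucys_murphy ?i) (vb ?A) = pscale ?d (vb ?A)"
      "j \<in> S \<Longrightarrow> free_on (free_jucys_murphy ?i) (vb ?B) = pscale (?d + 2) (vb ?B)"
    using Suc.IH[OF Suc.prems] Suc.IH[of ?A] Suc.IH[of ?B] A B by auto
  show ?case
  proof (cases "?i \<in> S")
    case True
    then show ?thesis
      by (simp add: on_basis_simps Y weight_Suc_Suc pscale.scale_left_diff_distrib)
  next
    case False
    \<comment> \<open>The simplifier writes \<open>?A\<close> and \<open>?B\<close> with
      \<open>insert\<close>; the eigenvalue equations must have that form to rewrite the
      goal.\<close>
    note Y' = Y[simplified]
    \<comment> \<open>The excess 2 in the eigenvalue of \<open>vb ?B\<close> must cancel the two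
      copies of \<open>- vb ?B\<close> coming from \<open>fs ?i\<close> and
      \<open>fe ?i\<close>.\<close>
    have two: "pscale 2 v = v + v" for v :: "nat set \<Rightarrow>\<^sub>0 complex"
      using pscale.scale_left_distrib[of 1 1 v] by simp
    show ?thesis
      by (cases "Suc ?i \<in> S"; cases "j \<in> S")
        (simp_all add: False free_on_mult free_on_fs free_on_fe free_on_left free_on_right
          free_on_add lin_ext_linear Y' two weight_Suc_Suc pscale.scale_left_distrib
          pscale.scale_right_diff_distrib)
  qed
qed simp

text \<open>By linearity an operator diagonal on basis vectors scales each coefficient separately.
  Only the support of \<open>v\<close> is constrained, since \<open>free_jucys_murphy_vb\<close>
  covers only sets without 0.\<close>

lemma lookup_free_on_diagonal:
  assumes "\<And>S. S \<in> Poly_Mapping.keys v \<Longrightarrow> free_on p (vb S) = pscale (c S) (vb S)"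
  shows "Poly_Mapping.lookup (free_on p v) S = c S * Poly_Mapping.lookup v S"
proof (induction v rule: pmap_induct)
  case (single T x)
  have "free_on p (Poly_Mapping.single T x) = pscale x (free_on p (vb T))"
    by (simp add: vb_def flip: free_on_pscale)
  then show ?case
    using assms[OF single] by (simp add: vb_def lookup_single when_def)
qed (simp_all add: free_on_add lookup_add distrib_left)

text \<open>A joint eigenvector has a nonzero coefficient at some \<open>S\<close>, and comparing
  coefficients there forces its eigenvalues to be \<open>weight S\<close>. Conversely,
  \<open>vb S\<close> is itself a joint eigenvector.\<close>

lemma Spec_C0: "Spec n (C0 n k) = {restrict (weight S) {1..n} | S. S \<subseteq> {1..n - 1} \<and> card S = k}"
proof -
  have diag: "Poly_Mapping.lookup (rep_act (C0 n k) (jucys_murphy n j) v) S =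
      weight S j * Poly_Mapping.lookup v S"
    if "j \<in> {1..n}" "v \<in> rep_space (C0 n k)" for j v S
  proof -
    obtain i where i: "j = Suc i" using \<open>j \<in> {1..n}\<close> by (cases j) auto
    have "0 \<notin> T" if "T \<in> Poly_Mapping.keys v" for T
      using that \<open>v \<in> rep_space (C0 n k)\<close> by (force simp: C0_def)
    then have "Poly_Mapping.lookup (free_on (free_jucys_murphy j) v) S =
        weight S j * Poly_Mapping.lookup v S"
      unfolding i by (intro lookup_free_on_diagonal free_jucys_murphy_vb)
    then show ?thesis
      using that(1) by (simp add: jucys_murphy_eq_class C0_act_class free_jucys_murphy_closed)
  qed
  show ?thesis
  proof (intro subset_antisym subsetI)
    fix \<alpha> assume "\<alpha> \<in> Spec n (C0 n k)"
    then obtain v where \<alpha>: "\<alpha> \<in> {1..n} \<rightarrow>\<^sub>E UNIV" and v: "v \<in> rep_space (C0 n k)" "v \<noteq> 0"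
      and eig: "\<And>j. j \<in> {1..n} \<Longrightarrow> rep_act (C0 n k) (jucys_murphy n j) v = pscale (\<alpha> j) v"
      by (auto simp: Spec_def C0_def)
    from v(2) obtain S where S: "S \<in> Poly_Mapping.keys v" by (auto simp flip: keys_eq_empty)
    have "\<alpha> j = weight S j" if "j \<in> {1..n}" for j
      using diag[OF that v(1), of S] eig[OF that] S by (simp add: in_keys_iff)
    then have "\<alpha> = restrict (weight S) {1..n}"
      using \<alpha> by (auto simp: PiE_def extensional_def)
    moreover have "S \<subseteq> {1..n - 1} \<and> card S = k" using S v(1) by (auto simp: C0_def)
    ultimately show "\<alpha> \<in> {restrict (weight S) {1..n} | S. S \<subseteq> {1..n - 1} \<and> card S = k}" by blast
  next
    fix \<alpha> assume "\<alpha> \<in> {restrict (weight S) {1..n} | S. S \<subseteq> {1..n - 1} \<and> card S = k}"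
    then obtain S where S: "S \<subseteq> {1..n - 1}" "card S = k" and \<alpha>: "\<alpha> = restrict (weight S) {1..n}"
      by blast
    have v: "vb S \<in> rep_space (C0 n k)" using S by (simp add: vb_def C0_def)
    have "rep_act (C0 n k) (jucys_murphy n j) (vb S) = rep_scale (C0 n k) (\<alpha> j) (vb S)"
      if "j \<in> {1..n}" for j
      using diag[OF that v] that
      by (intro poly_mapping_eqI) (auto simp: \<alpha> C0_def vb_def lookup_single when_def)
    moreover have "vb S \<noteq> 0" unfolding vb_def by (metis lookup_single_eq lookup_zero zero_neq_one)
    ultimately show "\<alpha> \<in> Spec n (C0 n k)" using v by (auto simp: Spec_def \<alpha>)
  qed
qed

text \<open>The row has length m = n - 2k and content m - 1; the column has length m = 2(k+1) - n
  and content 1 - m. Both equal n - 1 - 2k, and the case split keeps the natural subtractions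
  exact.\<close>

lemma content_row_or_column:
  assumes "k \<le> n - 1" "n \<ge> 1"
  shows "content (THE b. removable_box (row_or_column n k) b) = int n - 1 - 2 * int k"
proof (cases "int n - 2 * int k \<ge> 1")
  case True
  then show ?thesis
    using content_removable_row(2)[of "n - 2 * k"] by (simp add: row_or_column_def of_nat_diff)
next
  case False
  then show ?thesis
    using content_removable_column(2)[of "2 * (k + 1) - n"]
    by (simp add: row_or_column_def of_nat_diff)
qed

lemma weight_end:
  assumes "n \<ge> 1" "S \<subseteq> {1..n - 1}"
  shows "weight S n = of_int (int n - 1 - 2 * int (card S))"
proof -
  have "S \<inter> {1..<n} = S" using assms by fastforce
  then show ?thesis using assms(1) by (simp add: weight_def of_nat_diff)
qed

theorem mainTheorem9:
  fixes n k :: nat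
  assumes "n \<ge> 1" and "k \<le> n - 1"
  shows "Spec n (C0 n k) =
    {a \<in> {1..n} \<rightarrow>\<^sub>E \<int>.
       a 1 = 0 \<and>
       a n = of_int (content (THE b. removable_box (row_or_column n k) b)) \<and>
       (\<forall>i \<in> {1..n - 1}. a (i + 1) = a i + 1 \<or> a (i + 1) = a i - 1)}"
    (is "_ = ?R")
proof (intro subset_antisym subsetI)
  fix a assume "a \<in> Spec n (C0 n k)"
  then obtain S where S: "S \<subseteq> {1..n - 1}" "card S = k" and a: "a = restrict (weight S) {1..n}"
    unfolding Spec_C0 by blast
  have "a (i + 1) = a i + 1 \<or> a (i + 1) = a i - 1" if "i \<in> {1..n - 1}" for i
    using that weight_Suc_Suc[of S "i - 1"] by (auto simp: a)
  moreover have "weight S j \<in> \<int>" for j by (simp add: weight_def)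
  ultimately show "a \<in> ?R"
    using assms S by (auto simp: a content_row_or_column weight_end)
next
  fix a assume a: "a \<in> ?R"
  define S where "S = {i \<in> {1..n - 1}. a (i + 1) = a i - 1}"
  \<comment> \<open>Outside \<open>S\<close> the step is not down, so membership of \<open>a\<close>
    in the right-hand side forces it up.\<close>
  have step: "a (Suc (Suc j)) = a (Suc j) + (if Suc j \<in> S then -1 else 1)" if "Suc (Suc j) \<le> n" for j
    using a that unfolding S_def by fastforce
  have w: "a (Suc j) = weight S (Suc j)" if "Suc j \<le> n" for j
    using that
  proof (induction j)
    case 0 then show ?case using a by simp
  next
    case (Suc j) then show ?case by (simp add: step weight_Suc_Suc)
  qed
  have w': "a j = weight S j" if "j \<in> {1..n}" for j
    using w[of "j - 1"] that by simp
  then have "a = restrict (weight S) {1..n}"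
    using a by (auto simp: PiE_def extensional_def)
  moreover have S: "S \<subseteq> {1..n - 1}" by (auto simp: S_def)
  \<comment> \<open>The prescribed endpoint fixes the number of down-steps, as \<open>of_int\<close>
    is injective into the complex numbers.\<close>
  moreover have "card S = k"
  proof -
    have "(of_int (int n - 1 - 2 * int (card S)) :: complex) = of_int (int n - 1 - 2 * int k)"
      using a w'[of n] weight_end[OF assms(1) S] content_row_or_column[OF assms(2,1)] assms(1) by simp
    then have "int n - 1 - 2 * int (card S) = int n - 1 - 2 * int k"
      by (rule of_int_eq_iff[THEN iffD1])
    then show ?thesis by simp
  qed
  ultimately show "a \<in> Spec n (C0 n k)" unfolding Spec_C0 by blast
qed

end
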